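(* Let $F$ be a (plane) forest of size $n$. Define a map $\phi:(F,w)\mapsto(F,w')$ on $B_n(F)$ by requiring, for each vertex $u\in F$, that $w'(u)$ has the same sign as $-w(u)$ and that $|w'(u)|=n+1-|w(u)|$. Then $\phi$ is a bijection from $B_n(F)$ to itself such that, for every $(F,w)\in B_n(F)$ with $\phi(F,w)=(F,w')$, $$\mathrm{rmaj}(F,w)=\mathrm{fmaj}(F,w').$$
   Context: Notation: $[1,n]=\{1,\dots,n\}$. A forest $F$ is a (plane) rooted forest with vertex set $V(F)$; its vertices are regarded as distinguishable. Its size is the number of vertices. The hook length $h_u$ of a vertex $u$ is the number of vertices of the subtree rooted at $u$ (including $u$). A signed labeling of a forest $F$ of size $n$ is a map $w:V(F)\to\{\pm1,\dots,\pm n\}$ such that $u\mapsto|w(u)|$ is a bijection from $V(F)$ to $[1,n]$. $B_n(F)$ denotes the set of all signed labeled forests $(F,w)$ with underlying forest $F$, i.e. the set of all signed labelings of $F$. Labels are compared in the natural order of the integers. For $(F,w)\in B_n(F)$ define - $\mathrm{Des}(F,w)=\{u\in F: w(u)>w(v),\ v\text{ is the parent of }u\}$ (roots are never in this set); - $\mathrm{maj}(F,w)=\sum_{u\in\mathrm{Des}(F,w)}h_u$; - $\mathrm{n}_1(F,w)=$ the number of negative labels of $w$, and $\mathrm{p}(F,w)=$ the number of positive labels of $w$; - $\mathrm{fmaj}(F,w)=2\,\mathrm{maj}(F,w)+\mathrm{n}_1(F,w)$; - $\mathrm{Des}_B(F,w)=\mathrm{Des}(F,w)\cup\{u\in F: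 u\text{ is a root of }F\text{ with }w(u)>0\}$; - $\mathrm{maj}_B(F,w)=\sum_{u\in\mathrm{Des}_B(F,w)}h_u$; - $\mathrm{rmaj}(F,w)=2\,\mathrm{maj}_B(F,w)-\mathrm{p}(F,w)$. *)

theory Defs
  imports Main "HOL-Library.FuncSet"
begin

text \<open>
  A plane tree carries the names of its vertices, and the left-to-right order of siblings is the
  order of the list of branches. A plane forest is a list of such trees; its vertices are
  distinguishable exactly when no name occurs twice (\<open>plane_forest\<close> below).
\<close>

datatype 'a ptree = Node (root_of: 'a) (branches: "'a ptree list")

type_synonym 'a pforest = "'a ptree list"

fun tree_verts :: "'a ptree \<Rightarrow> 'a list" where
  "tree_verts (Node v ts) = v # concat (map tree_verts ts)"

definition forest_verts :: "'a pforest \<Rightarrow> 'a list" where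
  "forest_verts F = concat (map tree_verts F)"

definition plane_forest :: "'a pforest \<Rightarrow> bool" where
  "plane_forest F \<longleftrightarrow> distinct (forest_verts F)"

definition verts :: "'a pforest \<Rightarrow> 'a set" where
  "verts F = set (forest_verts F)"

definition forest_size :: "'a pforest \<Rightarrow> nat" where
  "forest_size F = card (verts F)"

fun tree_subtrees :: "'a ptree \<Rightarrow> 'a ptree set" where
  "tree_subtrees (Node v ts) = insert (Node v ts) (\<Union>t\<in>set ts. tree_subtrees t)"

definition subtrees :: "'a pforest \<Rightarrow> 'a ptree set" where
  "subtrees F = (\<Union>t\<in>set F. tree_subtrees t)"

definition roots :: "'a pforest \<Rightarrow> 'a set" where
  "roots F = root_of ` set F"

definition is_parent :: "'a pforest \<Rightarrow> 'a \<Rightarrow> 'a \<Rightarrow> bool" where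
  "is_parent F v u \<longleftrightarrow> (\<exists>t\<in>subtrees F. root_of t = v \<and> u \<in> root_of ` set (branches t))"

text \<open>In a plane forest every vertex is the root of exactly one subtree; see
  \<open>ex1_subtree\<close> below.\<close>

definition subtree_at :: "'a pforest \<Rightarrow> 'a \<Rightarrow> 'a ptree" where
  "subtree_at F u = (THE t. t \<in> subtrees F \<and> root_of t = u)"

definition hook_length :: "'a pforest \<Rightarrow> 'a \<Rightarrow> nat" where
  "hook_length F u = card (set (tree_verts (subtree_at F u)))"

text \<open>Labelings are extensional (undefined outside \<open>verts F\<close>), so that functions in this set correspond
  one-to-one to maps on \<open>verts F\<close>.\<close>

definition signed_labelings :: "nat \<Rightarrow> 'a pforest \<Rightarrow> ('a \<Rightarrow> int) set" where
  "signed_labelings n F =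
     {w \<in> verts F \<rightarrow>\<^sub>E ({- int n..-1} \<union> {1..int n}). bij_betw (\<lambda>u. \<bar>w u\<bar>) (verts F) {1..int n}}"

definition Des :: "'a pforest \<Rightarrow> ('a \<Rightarrow> int) \<Rightarrow> 'a set" where
  "Des F w = {u \<in> verts F. \<exists>v. is_parent F v u \<and> w u > w v}"

definition maj :: "'a pforest \<Rightarrow> ('a \<Rightarrow> int) \<Rightarrow> nat" where
  "maj F w = (\<Sum>u\<in>Des F w. hook_length F u)"

definition neg_count :: "'a pforest \<Rightarrow> ('a \<Rightarrow> int) \<Rightarrow> nat" where
  "neg_count F w = card {u \<in> verts F. w u < 0}"

definition pos_count :: "'a pforest \<Rightarrow> ('a \<Rightarrow> int) \<Rightarrow> nat" where
  "pos_count F w = card {u \<in> verts F. w u > 0}"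

definition fmaj :: "'a pforest \<Rightarrow> ('a \<Rightarrow> int) \<Rightarrow> nat" where
  "fmaj F w = 2 * maj F w + neg_count F w"

definition Des_B :: "'a pforest \<Rightarrow> ('a \<Rightarrow> int) \<Rightarrow> 'a set" where
  "Des_B F w = Des F w \<union> {u \<in> roots F. w u > 0}"

definition maj_B :: "'a pforest \<Rightarrow> ('a \<Rightarrow> int) \<Rightarrow> nat" where
  "maj_B F w = (\<Sum>u\<in>Des_B F w. hook_length F u)"

text \<open>Integer-valued, to avoid truncated subtraction.\<close>

definition rmaj :: "'a pforest \<Rightarrow> ('a \<Rightarrow> int) \<Rightarrow> int" where
  "rmaj F w = 2 * int (maj_B F w) - int (pos_count F w)"

text \<open>For a signed labeling \<open>w\<close>, the factor \<open>int n + 1 - \<bar>w u\<bar>\<close> is positive, hence it is the absolute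
  value of the new label and \<open>sgn (- w u)\<close> is its sign.\<close>

definition phi :: "nat \<Rightarrow> 'a pforest \<Rightarrow> ('a \<Rightarrow> int) \<Rightarrow> ('a \<Rightarrow> int)" where
  "phi n F w = (\<lambda>u\<in>verts F. sgn (- w u) * (int n + 1 - \<bar>w u\<bar>))"

lemma tree_subtrees_verts: "s \<in> tree_subtrees t \<Longrightarrow> root_of s \<in> set (tree_verts t)"
  by (induction t) auto

lemma ex_tree_subtree: "u \<in> set (tree_verts t) \<Longrightarrow> \<exists>s\<in>tree_subtrees t. root_of s = u"
  by (induction t) fastforce

lemma distinct_concat_map_eq:
  assumes "distinct (concat (map f ts))" "s \<in> set ts" "t \<in> set ts" "x \<in> set (f s)" "x \<in> set (f t)"
  shows "s = t"
  using assms by (induction ts) auto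

lemma distinct_concat_mapD: "distinct (concat (map f ts)) \<Longrightarrow> t \<in> set ts \<Longrightarrow> distinct (f t)"
  by (induction ts) auto

lemma tree_subtree_unique:
  "distinct (tree_verts t) \<Longrightarrow> r \<in> tree_subtrees t \<Longrightarrow> s \<in> tree_subtrees t \<Longrightarrow>
    root_of r = root_of s \<Longrightarrow> r = s"
proof (induction t)
  case (Node v ts)
  have *: "root_of q \<noteq> v" if "t \<in> set ts" "q \<in> tree_subtrees t" for q t
    using Node.prems(1) tree_subtrees_verts[OF that(2)] that(1) by auto
  have d: "distinct (concat (map tree_verts ts))"
    using Node.prems(1) by simp
  show ?case
  proof (cases "r = Node v ts \<or> s = Node v ts")
    case True
    then show ?thesis
    proof
      assume r: "r = Node v ts"
      then have "root_of s = v"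
        using Node.prems(4) by simp
      then show ?thesis
        using r Node.prems(3) * by fastforce
    next
      assume s: "s = Node v ts"
      then have "root_of r = v"
        using Node.prems(4) by simp
      then show ?thesis
        using s Node.prems(2) * by fastforce
    qed
  next
    case False
    then obtain t t' where t: "t \<in> set ts" "r \<in> tree_subtrees t" "t' \<in> set ts" "s \<in> tree_subtrees t'"
      using Node.prems(2,3) by auto
    then have "t = t'"
      using distinct_concat_map_eq[OF d] tree_subtrees_verts Node.prems(4) by metis
    then show ?thesis
      using Node.IH[OF t(1)] distinct_concat_mapD[OF d t(1)] t Node.prems(4) by blast
  qed
qed

lemma ex1_subtree:
  assumes "plane_forest F" "u \<in> verts F"
  shows "\<exists>!t. t \<in> subtrees F \<and> root_of t = u"
proof -
  have d: "distinct (concat (map tree_verts F))"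
    using assms(1) by (simp add: plane_forest_def forest_verts_def)
  obtain t s where ts: "t \<in> set F" "s \<in> tree_subtrees t" "root_of s = u"
    using assms(2) ex_tree_subtree by (fastforce simp: verts_def forest_verts_def)
  have "r = s" if r: "r \<in> subtrees F" "root_of r = u" for r
  proof -
    obtain t' where t': "t' \<in> set F" "r \<in> tree_subtrees t'"
      using r(1) unfolding subtrees_def by blast
    have "t' = t"
      using distinct_concat_map_eq[OF d t'(1) ts(1)] tree_subtrees_verts t'(2) ts(2,3) r(2) by metis
    then show ?thesis
      using tree_subtree_unique[OF distinct_concat_mapD[OF d ts(1)]] t'(2) ts(2,3) r(2) by simp
  qed
  then show ?thesis
    using ts by (auto simp: subtrees_def)
qed

end

theory Submission imports Defs begin

text \<open>
  Write \<open>w'\<close> for the image of \<open>w\<close> under \<open>phi\<close>: positive labels are shifted down by \<open>n + 1\<close> and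
  negative ones up by \<open>n + 1\<close>. All signs are reversed, and the order within each sign class is kept.
  That \<open>phi\<close> is an involution, hence bijective, is immediate.

  The negative labels of \<open>w'\<close> sit at the positive labels of \<open>w\<close>, so the identity of statistics
  amounts to \<open>maj_B F w = maj F w' + pos_count F w\<close>. Let \<open>x u\<close> be \<open>1\<close> if \<open>w u > 0\<close> and \<open>0\<close> otherwise,
  and let a root have a fictitious parent with \<open>x = 0\<close>. Comparing \<open>u\<close> with its parent \<open>v\<close>, the
  two labelings disagree on whether \<open>u\<close> is a descent only if the signs at \<open>u\<close> and \<open>v\<close> differ,
  and in every case \<open>[u \<in> Des_B F w] - [u \<in> Des F w'] = x u - x v\<close> (\<open>Des_B_phi\<close>). Weighting by hook
  lengths and summing over \<open>u\<close>, the coefficient of \<open>x v\<close> is the hook length of \<open>v\<close> minus the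
  hook lengths of its children, which is \<open>1\<close> (\<open>hook_length_children\<close>); so the sum telescopes to
  the number of positive labels (\<open>sum_hook_length_parents\<close>).
\<close>

section \<open>Parents and children in a plane forest\<close>

lemma root_in_tree_verts [simp]: "root_of t \<in> set (tree_verts t)"
  by (cases t) auto

lemma tree_subtrees_self [simp]: "t \<in> tree_subtrees t"
  by (cases t) auto

lemma tree_subtrees_trans: "r \<in> tree_subtrees s \<Longrightarrow> s \<in> tree_subtrees t \<Longrightarrow> r \<in> tree_subtrees t"
  by (induction t) auto

lemma branch_in_tree_subtrees:
  assumes "s \<in> tree_subtrees t" "c \<in> set (branches s)"
  shows "c \<in> tree_subtrees t"
proof -
  have "c \<in> tree_subtrees s"
    using assms(2) by (cases s) (auto intro!: bexI[of _ c])
  then show ?thesis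
    using assms(1) tree_subtrees_trans by blast
qed

lemma branch_in_subtrees: "s \<in> subtrees F \<Longrightarrow> c \<in> set (branches s) \<Longrightarrow> c \<in> subtrees F"
  unfolding subtrees_def using branch_in_tree_subtrees by blast

lemma size_tree_subtrees: "s \<in> tree_subtrees t \<Longrightarrow> size s \<le> size t"
proof (induction t)
  case (Node v ts)
  then show ?case
    by (force dest: size_list_estimation'[where f = size])
qed

lemma size_branch: "c \<in> set (branches s) \<Longrightarrow> size c < size s"
  by (cases s) (auto simp: less_Suc_eq_le intro: size_list_estimation')

lemma distinct_tree_subtrees:
  "s \<in> tree_subtrees t \<Longrightarrow> distinct (tree_verts t) \<Longrightarrow> distinct (tree_verts s)"
proof (induction t)
  case (Node v ts)
  then show ?case
    by (auto dest: distinct_concat_mapD)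
qed

lemma plane_forest_distinct_tree:
  "plane_forest F \<Longrightarrow> t \<in> set F \<Longrightarrow> distinct (tree_verts t)"
  unfolding plane_forest_def forest_verts_def by (rule distinct_concat_mapD)

lemma plane_forest_same_tree:
  assumes "plane_forest F" "s \<in> set F" "t \<in> set F" "x \<in> set (tree_verts s)" "x \<in> set (tree_verts t)"
  shows "s = t"
  using assms distinct_concat_map_eq unfolding plane_forest_def forest_verts_def by metis

lemma root_subtree_in_verts: "t \<in> subtrees F \<Longrightarrow> root_of t \<in> verts F"
  by (auto simp: subtrees_def verts_def forest_verts_def dest: tree_subtrees_verts)

lemma plane_forest_same_subtree:
  assumes "plane_forest F" "s \<in> subtrees F" "t \<in> subtrees F" "root_of s = root_of t"
  shows "s = t"
  using ex1_subtree[OF assms(1) root_subtree_in_verts[OF assms(3)]] assms(2-4) by blast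

lemma finite_verts [simp]: "finite (verts F)"
  by (simp add: verts_def)

lemma roots_subset_verts: "roots F \<subseteq> verts F"
  by (auto simp: roots_def verts_def forest_verts_def)

lemma is_parent_in_verts:
  assumes "is_parent F v u"
  shows "v \<in> verts F" "u \<in> verts F"
  using assms unfolding is_parent_def
  by (auto intro: root_subtree_in_verts branch_in_subtrees)

text \<open>A root that was also a child would force a tree of the forest to be a proper subtree of
  itself, which its size forbids.\<close>

lemma root_not_branch:
  assumes F: "plane_forest F" and s: "s \<in> subtrees F" and c: "c \<in> set (branches s)"
  shows "root_of c \<notin> roots F"
proof
  assume "root_of c \<in> roots F"
  then obtain r where r: "r \<in> set F" "root_of r = root_of c"
    unfolding roots_def by force
  obtain t where t: "t \<in> set F" "s \<in> tree_subtrees t"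
    using s unfolding subtrees_def by blast
  have ct: "c \<in> tree_subtrees t"
    using branch_in_tree_subtrees t(2) c by blast
  have "r \<in> subtrees F" "c \<in> subtrees F"
    using r(1) ct t(1) tree_subtrees_self unfolding subtrees_def by blast+
  then have rc: "r = c"
    using plane_forest_same_subtree[OF F] r(2) by blast
  have "r = t"
    using plane_forest_same_tree[OF F r(1) t(1), of "root_of c"] tree_subtrees_verts[OF ct] rc by simp
  then show False
    using size_tree_subtrees[OF t(2)] size_branch[OF c] rc by simp
qed

lemma root_no_parent: "plane_forest F \<Longrightarrow> u \<in> roots F \<Longrightarrow> \<not> is_parent F v u"
  unfolding is_parent_def using root_not_branch by fastforce

text \<open>Either the common child is a root of the forest of branches, and then only the top vertex can be
  its parent, or both parents lie below the top, in the one branch that contains the child.\<close>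

lemma tree_parent_unique:
  assumes "distinct (tree_verts t)" "s \<in> tree_subtrees t" "s' \<in> tree_subtrees t"
    "c \<in> set (branches s)" "c' \<in> set (branches s')" "root_of c = root_of c'"
  shows "s = s'"
  using assms
proof (induction t)
  case (Node v ts)
  have pf: "plane_forest ts"
    using Node.prems(1) by (simp add: plane_forest_def forest_verts_def)
  have top: "r = Node v ts"
    if "r \<in> tree_subtrees (Node v ts)" "d \<in> set (branches r)" "root_of d \<in> roots ts" for r d
    using root_not_branch[OF pf, of r d] that by (auto simp: subtrees_def)
  show ?case
  proof (cases "s = Node v ts \<or> s' = Node v ts")
    case True
    then have "root_of c \<in> roots ts"
      using Node.prems(4-6) unfolding roots_def by (auto intro: rev_image_eqI)
    then show ?thesis
      using top[OF Node.prems(2,4)] top[OF Node.prems(3,5)] Node.prems(6) by simp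
  next
    case False
    then obtain t t' where t: "t \<in> set ts" "s \<in> tree_subtrees t" "t' \<in> set ts" "s' \<in> tree_subtrees t'"
      using Node.prems(2,3) by auto
    have "root_of c \<in> set (tree_verts t)" "root_of c' \<in> set (tree_verts t')"
      using tree_subtrees_verts branch_in_tree_subtrees t(2,4) Node.prems(4,5) by blast+
    then have "t = t'"
      using plane_forest_same_tree[OF pf t(1,3)] Node.prems(6) by simp
    then show ?thesis
      using Node.IH[OF t(1) plane_forest_distinct_tree[OF pf t(1)]] t Node.prems(4-6) by blast
  qed
qed

lemma parent_unique:
  assumes F: "plane_forest F" and "is_parent F v u" "is_parent F v' u"
  shows "v = v'"
proof -
  obtain s c where s: "s \<in> subtrees F" "root_of s = v" "c \<in> set (branches s)" "root_of c = u"
    using assms(2) unfolding is_parent_def by blast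
  obtain s' c' where s': "s' \<in> subtrees F" "root_of s' = v'" "c' \<in> set (branches s')" "root_of c' = u"
    using assms(3) unfolding is_parent_def by blast
  obtain t where t: "t \<in> set F" "s \<in> tree_subtrees t"
    using s(1) unfolding subtrees_def by blast
  obtain t' where t': "t' \<in> set F" "s' \<in> tree_subtrees t'"
    using s'(1) unfolding subtrees_def by blast
  have "u \<in> set (tree_verts t)"
    using tree_subtrees_verts[OF branch_in_tree_subtrees[OF t(2) s(3)]] s(4) by simp
  moreover have "u \<in> set (tree_verts t')"
    using tree_subtrees_verts[OF branch_in_tree_subtrees[OF t'(2) s'(3)]] s'(4) by simp
  ultimately have "t = t'"
    using plane_forest_same_tree[OF F t(1) t'(1)] by blast
  then have "s = s'"
    using tree_parent_unique[OF plane_forest_distinct_tree[OF F t(1)] t(2) _ s(3) s'(3)]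
      t'(2) s(4) s'(4) by simp
  then show ?thesis
    using s(2) s'(2) by simp
qed

lemma tree_parent_exists:
  "s \<in> tree_subtrees t \<Longrightarrow> s \<noteq> t \<Longrightarrow> \<exists>r\<in>tree_subtrees t. s \<in> set (branches r)"
proof (induction t)
  case (Node v ts)
  then obtain t where t: "t \<in> set ts" "s \<in> tree_subtrees t"
    by auto
  show ?case
    using Node.IH[OF t] t(1) by (cases "s = t") auto
qed

lemma nonroot_has_parent:
  assumes "plane_forest F" "u \<in> verts F" "u \<notin> roots F"
  shows "\<exists>v. is_parent F v u"
proof -
  obtain s t where "t \<in> set F" "s \<in> tree_subtrees t" "root_of s = u"
    using ex1_subtree[OF assms(1,2)] unfolding subtrees_def by blast
  moreover from this have "s \<noteq> t"
    using assms(3) unfolding roots_def by auto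
  ultimately show ?thesis
    using tree_parent_exists[of s t] unfolding is_parent_def subtrees_def by blast
qed

section \<open>Summation by hook lengths\<close>

lemma hook_length_root:
  assumes "plane_forest F" "t \<in> subtrees F"
  shows "hook_length F (root_of t) = card (set (tree_verts t))"
proof -
  have "subtree_at F (root_of t) = t"
    unfolding subtree_at_def using assms plane_forest_same_subtree by (intro the_equality) auto
  then show ?thesis
    by (simp add: hook_length_def)
qed

lemma hook_length_children:
  assumes F: "plane_forest F" and "v \<in> verts F"
  shows "hook_length F v = 1 + (\<Sum>u | u \<in> verts F \<and> is_parent F v u. hook_length F u)"
proof -
  obtain t where t: "t \<in> subtrees F" "root_of t = v"
    using ex1_subtree[OF assms] by blast
  obtain ts where ts: "t = Node v ts"
    using t(2) by (cases t) auto
  have children: "{u. u \<in> verts F \<and> is_parent F v u} = root_of ` set ts"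
  proof -
    have "is_parent F v u \<longleftrightarrow> u \<in> root_of ` set ts" for u
    proof
      assume "is_parent F v u"
      then obtain s where s: "s \<in> subtrees F" "root_of s = v" "u \<in> root_of ` set (branches s)"
        unfolding is_parent_def by blast
      then have "s = t"
        using plane_forest_same_subtree[OF F s(1) t(1)] t(2) by simp
      then show "u \<in> root_of ` set ts"
        using s(3) ts by simp
    next
      assume "u \<in> root_of ` set ts"
      then show "is_parent F v u"
        unfolding is_parent_def using t ts by (intro bexI[of _ t]) simp_all
    qed
    then show ?thesis
      using is_parent_in_verts(2)[of F v] by blast
  qed
  have "distinct (tree_verts t)"
    using t(1) distinct_tree_subtrees plane_forest_distinct_tree[OF F] unfolding subtrees_def by blast
  then have d: "distinct (concat (map tree_verts ts))" and v: "v \<notin> (\<Union>c\<in>set ts. set (tree_verts c))"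
    unfolding ts by auto
  have disj: "set (tree_verts c) \<inter> set (tree_verts c') = {}" if "c \<in> set ts" "c' \<in> set ts" "c \<noteq> c'" for c c'
    using distinct_concat_map_eq[OF d] that by blast
  have inj: "inj_on root_of (set ts)"
    using disj root_in_tree_verts by (metis disjoint_iff inj_onI)
  have "hook_length F v = card (insert v (\<Union>c\<in>set ts. set (tree_verts c)))"
    using hook_length_root[OF F t(1)] t(2) ts by simp
  also have "\<dots> = 1 + card (\<Union>c\<in>set ts. set (tree_verts c))"
    using v by (subst card_insert_disjoint) auto
  also have "card (\<Union>c\<in>set ts. set (tree_verts c)) = (\<Sum>c\<in>set ts. card (set (tree_verts c)))"
    using disj by (intro card_UN_disjoint) auto
  also have "\<dots> = (\<Sum>c\<in>set ts. hook_length F (root_of c))"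
    using hook_length_root[OF F] branch_in_subtrees[OF t(1)] ts by (intro sum.cong) auto
  also have "\<dots> = (\<Sum>u | u \<in> verts F \<and> is_parent F v u. hook_length F u)"
    unfolding children by (simp add: sum.reindex[OF inj])
  finally show ?thesis .
qed

text \<open>Exchanging the order of summation collects, for each \<open>v\<close>, the hook lengths of its children;
  by \<open>hook_length_children\<close> these fall short of the hook length of \<open>v\<close> by exactly \<open>1\<close>.
  The inner sum on the left has at most one term, the value of \<open>x\<close> at the parent of \<open>u\<close>;
  writing it as a sum makes it vanish at the roots.\<close>

lemma sum_hook_length_parents:
  fixes x :: "'a \<Rightarrow> int"
  assumes F: "plane_forest F"
  shows "(\<Sum>u\<in>verts F. int (hook_length F u) * (x u - (\<Sum>v | v \<in> verts F \<and> is_parent F v u. x v)))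
    = (\<Sum>v\<in>verts F. x v)"
proof -
  let ?h = "\<lambda>u. int (hook_length F u)"
  have "(\<Sum>u\<in>verts F. ?h u * (\<Sum>v | v \<in> verts F \<and> is_parent F v u. x v))
      = (\<Sum>u\<in>verts F. \<Sum>v | v \<in> verts F \<and> is_parent F v u. ?h u * x v)"
    by (simp add: sum_distrib_left)
  also have "\<dots> = (\<Sum>v\<in>verts F. \<Sum>u | u \<in> verts F \<and> is_parent F v u. ?h u * x v)"
    by (rule sum.swap_restrict) auto
  also have "\<dots> = (\<Sum>v\<in>verts F. (?h v - 1) * x v)"
    by (intro sum.cong refl) (simp add: hook_length_children[OF F] sum_distrib_right)
  finally show ?thesis
    by (simp add: right_diff_distrib sum_subtractf algebra_simps)
qed

section \<open>The reflection of signed labelings\<close>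

lemma signed_labelings_range:
  assumes "w \<in> signed_labelings n F" "u \<in> verts F"
  shows "1 \<le> \<bar>w u\<bar>" "\<bar>w u\<bar> \<le> int n"
proof -
  have "\<bar>w u\<bar> \<in> {1..int n}"
    using assms bij_betwE unfolding signed_labelings_def by blast
  then show "1 \<le> \<bar>w u\<bar>" "\<bar>w u\<bar> \<le> int n"
    by simp_all
qed

lemma sgn_abs_phi:
  assumes "w \<in> signed_labelings n F" "u \<in> verts F"
  shows "sgn (phi n F w u) = sgn (- w u)" "\<bar>phi n F w u\<bar> = int n + 1 - \<bar>w u\<bar>"
  using signed_labelings_range[OF assms] assms(2) by (auto simp: phi_def sgn_if)

lemma phi_shift:
  assumes "w \<in> signed_labelings n F" "u \<in> verts F"
  shows "phi n F w u = (if w u > 0 then w u - (int n + 1) else w u + (int n + 1))"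
  using signed_labelings_range[OF assms] assms(2) by (auto simp: phi_def sgn_if)

lemma phi_in_signed_labelings:
  assumes w: "w \<in> signed_labelings n F"
  shows "phi n F w \<in> signed_labelings n F"
proof -
  have "phi n F w \<in> verts F \<rightarrow>\<^sub>E ({- int n..-1} \<union> {1..int n})"
  proof (rule PiE_I)
    fix u assume u: "u \<in> verts F"
    show "phi n F w u \<in> {- int n..-1} \<union> {1..int n}"
      using signed_labelings_range[OF w u] phi_shift[OF w u] by (auto split: if_splits)
  qed (simp add: phi_def)
  moreover have "bij_betw (\<lambda>u. \<bar>phi n F w u\<bar>) (verts F) {1..int n}"
  proof -
    have "bij_betw (\<lambda>k. int n + 1 - k) {1..int n} {1..int n}"
      by (rule bij_betw_byWitness[where f' = "\<lambda>k. int n + 1 - k"]) auto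
    then have "bij_betw ((\<lambda>k. int n + 1 - k) \<circ> (\<lambda>u. \<bar>w u\<bar>)) (verts F) {1..int n}"
      using w unfolding signed_labelings_def by (blast intro: bij_betw_trans)
    then show ?thesis
      by (rule bij_betw_cong[THEN iffD1, rotated]) (simp add: sgn_abs_phi(2)[OF w])
  qed
  ultimately show ?thesis
    by (simp add: signed_labelings_def)
qed

lemma phi_involution:
  assumes w: "w \<in> signed_labelings n F"
  shows "phi n F (phi n F w) = w"
proof
  fix u
  show "phi n F (phi n F w) u = w u"
  proof (cases "u \<in> verts F")
    case True
    then show ?thesis
      using phi_shift[OF w True] phi_shift[OF phi_in_signed_labelings[OF w] True]
        signed_labelings_range[OF w True] by (auto split: if_splits)
  next
    case False
    then show ?thesis
      using w by (auto simp: phi_def signed_labelings_def PiE_def extensional_def)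
  qed
qed

lemma neg_count_phi:
  assumes w: "w \<in> signed_labelings n F"
  shows "neg_count F (phi n F w) = pos_count F w"
proof -
  have "phi n F w u < 0 \<longleftrightarrow> w u > 0" if "u \<in> verts F" for u
    using phi_shift[OF w that] signed_labelings_range[OF w that] by (auto split: if_splits)
  then show ?thesis
    unfolding neg_count_def pos_count_def by (intro arg_cong[where f = card] Collect_cong) blast
qed

text \<open>Every label that was positive moves below every label that was negative, so across
  different signs the order is reversed, while it is kept within a sign. A root is in no set \<open>Des\<close>
  and in \<open>Des_B F w\<close> exactly when it is positive, which is the same formula with an empty sum.\<close>

lemma Des_B_phi:
  assumes F: "plane_forest F" and w: "w \<in> signed_labelings n F" and u: "u \<in> verts F"
  shows "of_bool (u \<in> Des_B F w) = (of_bool (u \<in> Des F (phi n F w)) :: int)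
    + (of_bool (w u > 0) - (\<Sum>v | v \<in> verts F \<and> is_parent F v u. of_bool (w v > 0)))"
proof (cases "u \<in> roots F")
  case True
  then have "\<not> is_parent F v u" for v
    using root_no_parent[OF F] by blast
  then show ?thesis
    using True by (simp add: Des_B_def Des_def)
next
  case False
  then obtain p where p: "is_parent F p u"
    using nonroot_has_parent[OF F u] by blast
  have p_iff: "is_parent F v u \<longleftrightarrow> v = p" for v
    using p parent_unique[OF F] by blast
  have pv: "p \<in> verts F"
    using is_parent_in_verts(1)[OF p] .
  have "{v. v \<in> verts F \<and> is_parent F v u} = {p}"
    using p_iff pv by auto
  moreover have "u \<in> Des F g \<longleftrightarrow> g u > g p" for g
    using u by (simp add: Des_def p_iff)
  ultimately show ?thesis
    using False phi_shift[OF w u] phi_shift[OF w pv]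
      signed_labelings_range[OF w u] signed_labelings_range[OF w pv]
    by (auto simp: Des_B_def)
qed

lemma maj_B_phi:
  assumes F: "plane_forest F" and w: "w \<in> signed_labelings n F"
  shows "maj_B F w = maj F (phi n F w) + pos_count F w"
proof -
  let ?h = "\<lambda>u. int (hook_length F u)"
  let ?x = "\<lambda>u. of_bool (w u > 0) :: int"
  have restrict: "int (\<Sum>u\<in>D. hook_length F u) = (\<Sum>u\<in>verts F. ?h u * of_bool (u \<in> D))"
    if "D \<subseteq> verts F" for D
  proof -
    have "int (\<Sum>u\<in>D. hook_length F u) = (\<Sum>u\<in>D. ?h u * of_bool (u \<in> D))"
      unfolding of_nat_sum by (intro sum.cong refl) simp
    also have "\<dots> = (\<Sum>u\<in>verts F. ?h u * of_bool (u \<in> D))"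
      using that by (intro sum.mono_neutral_left) auto
    finally show ?thesis .
  qed
  have "Des_B F w \<subseteq> verts F" "Des F (phi n F w) \<subseteq> verts F"
    using roots_subset_verts[of F] by (auto simp: Des_B_def Des_def)
  note Des = this[THEN restrict]
  have "int (maj_B F w) = (\<Sum>u\<in>verts F. ?h u * of_bool (u \<in> Des_B F w))"
    unfolding maj_B_def by (rule Des(1))
  also have "\<dots> = (\<Sum>u\<in>verts F. ?h u * of_bool (u \<in> Des F (phi n F w))
      + ?h u * (?x u - (\<Sum>v | v \<in> verts F \<and> is_parent F v u. ?x v)))"
    by (intro sum.cong refl) (simp only: Des_B_phi[OF F w] distrib_left)
  also have "\<dots> = int (maj F (phi n F w)) + (\<Sum>u\<in>verts F. ?x u)"
    unfolding maj_def Des(2) sum.distrib sum_hook_length_parents[OF F] ..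
  also have "(\<Sum>u\<in>verts F. ?x u) = int (pos_count F w)"
    unfolding pos_count_def by (subst sum_of_bool_eq) (simp_all add: Int_def)
  finally show ?thesis
    by linarith
qed

theorem theorem5p1:
  fixes F :: "'a pforest" and n :: nat
  assumes "plane_forest F" and "forest_size F = n"
  shows "(\<forall>w\<in>signed_labelings n F. \<forall>u\<in>verts F.
            sgn (phi n F w u) = sgn (- w u) \<and> \<bar>phi n F w u\<bar> = int n + 1 - \<bar>w u\<bar>)
       \<and> bij_betw (phi n F) (signed_labelings n F) (signed_labelings n F)
       \<and> (\<forall>w\<in>signed_labelings n F. rmaj F w = int (fmaj F (phi n F w)))"
proof (intro conjI ballI)
  show "bij_betw (phi n F) (signed_labelings n F) (signed_labelings n F)"
    by (rule bij_betw_byWitness[where f' = "phi n F"])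
      (auto simp: phi_involution phi_in_signed_labelings)
next
  fix w assume w: "w \<in> signed_labelings n F"
  show "rmaj F w = int (fmaj F (phi n F w))"
    using maj_B_phi[OF assms(1) w] neg_count_phi[OF w] by (simp add: rmaj_def fmaj_def)
next
  fix w u assume "w \<in> signed_labelings n F" "u \<in> verts F"
  then show "sgn (phi n F w u) = sgn (- w u)" "\<bar>phi n F w u\<bar> = int n + 1 - \<bar>w u\<bar>"
    by (rule sgn_abs_phi)+
qed

end
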